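(* Suppose that $\mathbf{a},\mathbf{b}$ are disjoint infinite subsets of $\mathbb{D}$, each satisfying Blaschke's condition, and such that $$\lim\mathbf{a}\not\subset\lim\mathbf{b}\quad\text{and}\quad\lim\mathbf{b}\not\subset\lim\mathbf{a}.$$ Then $\mathcal{Z}_{\mathbf{a}}\cap\mathcal{Z}_{\mathbf{b}}^\perp=\mathcal{Z}_{\mathbf{a}}^\perp\cap\mathcal{Z}_{\mathbf{b}}=\{0\}$.
   Context: $H^2$ is the Hardy space of the unit disk $\mathbb{D}$. A set $\mathbf{a}=\{a_k:k\ge1\}\subset\mathbb{D}$ satisfies Blaschke's condition if $\sum_k(1-|a_k|)<\infty$. $\mathcal{Z}_{\mathbf{a}}=\{f\in H^2:f(a)=0\text{ for all }a\in\mathbf{a}\}$ and similarly for $\mathbf{b}$; orthogonal complements are taken in $H^2$. $\lim\mathbf{a}=\overline{\mathbf{a}}\setminus\mathbf{a}\subset\mathbb{T}$ is the limit set of $\mathbf{a}$. *)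

theory Defs
  imports "HOL-Complex_Analysis.Complex_Analysis"
begin

definition taylor_coeff :: "(complex \<Rightarrow> complex) \<Rightarrow> nat \<Rightarrow> complex" where
  "taylor_coeff f n = (deriv ^^ n) f 0 / fact n"

text \<open>
  The Hardy space of the unit disk: holomorphic functions on the disk with square-summable
  Taylor coefficients at the origin. A function on the disk is represented by the total
  function that extends it by zero, so that equality of elements is equality on the disk and the
  zero element is \<open>\<lambda>_. 0\<close>.
\<close>
definition hardy2 :: "(complex \<Rightarrow> complex) set" where
  "hardy2 = {f. f holomorphic_on ball 0 1 \<and> (\<forall>z. z \<notin> ball 0 1 \<longrightarrow> f z = 0) \<and>
                summable (\<lambda>n. (cmod (taylor_coeff f n))\<^sup>2)}"

text \<open>The series converges absolutely for elements of \<open>hardy2\<close>, by Cauchy--Schwarz.\<close>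
definition hardy2_inner :: "(complex \<Rightarrow> complex) \<Rightarrow> (complex \<Rightarrow> complex) \<Rightarrow> complex" where
  "hardy2_inner f g = (\<Sum>n. taylor_coeff f n * cnj (taylor_coeff g n))"

definition hardy2_orth :: "(complex \<Rightarrow> complex) set \<Rightarrow> (complex \<Rightarrow> complex) set" where
  "hardy2_orth S = {f \<in> hardy2. \<forall>g\<in>S. hardy2_inner f g = 0}"

definition zero_space :: "complex set \<Rightarrow> (complex \<Rightarrow> complex) set" where
  "zero_space A = {f \<in> hardy2. \<forall>a\<in>A. f a = 0}"

text \<open>The sum runs over the set of points, each counted once; the terms are positive on the disk,
  so summability forces \<open>A\<close> to be countable.\<close>
definition blaschke_condition :: "complex set \<Rightarrow> bool" where
  "blaschke_condition A \<longleftrightarrow> (\<lambda>a. 1 - cmod a) summable_on A"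

definition limit_set :: "complex set \<Rightarrow> complex set" where
  "limit_set A = closure A - A"

end

theory Submission
  imports Defs
begin

text \<open>
  Let \<open>f\<close> be orthogonal to \<open>zero_space B\<close> and let \<open>b\<^sub>j\<close> enumerate \<open>B\<close>. The Takenaka--Malmquist functions
  \<open>e\<^sub>j\<close>, which are normalised Szego kernels at \<open>b\<^sub>j\<close> times the Blaschke product of the earlier points,
  are orthonormal and rational with poles at the reflections \<open>1 / cnj b\<^sub>i\<close>. By Blaschke's condition
  \<open>|e\<^sub>j(w)| \<le> M * sqrt (1 - |b\<^sub>j|\<^sup>2)\<close> locally uniformly on the disk and also around every boundary point
  off the closure of \<open>B\<close>, so by Bessel's inequality the Fourier series of \<open>f\<close> converges there to an
  analytic function. On the disk the sum is \<open>f\<close>. If \<open>f\<close> also vanishes on \<open>A\<close> and some limit point of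
  \<open>A\<close> is not a limit point of \<open>B\<close>, the zeros of the continued \<open>f\<close> accumulate in its domain and \<open>f = 0\<close>.
\<close>

subsection \<open>Taylor coefficients\<close>

lemma taylor_coeff_fps_nth: "f has_fps_expansion F \<Longrightarrow> taylor_coeff f n = fps_nth F n"
  unfolding taylor_coeff_def by (simp add: fps_nth_fps_expansion)

lemma has_fps_expansion_taylor:
  assumes "f holomorphic_on ball 0 1"
  shows "f has_fps_expansion Abs_fps (taylor_coeff f)"
proof -
  have "f has_fps_expansion fps_expansion f 0"
    by (rule has_fps_expansion_fps_expansion[OF _ _ assms]) auto
  also have "fps_expansion f 0 = Abs_fps (taylor_coeff f)"
    by (simp add: fps_expansion_def taylor_coeff_def[abs_def])
  finally show ?thesis .
qed

lemma taylor_coeff_add: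
  assumes "f holomorphic_on ball 0 1" "g holomorphic_on ball 0 1"
  shows "taylor_coeff (\<lambda>z. f z + g z) n = taylor_coeff f n + taylor_coeff g n"
  using taylor_coeff_fps_nth[OF has_fps_expansion_add[OF assms[THEN has_fps_expansion_taylor]]] by simp

lemma taylor_coeff_diff:
  assumes "f holomorphic_on ball 0 1" "g holomorphic_on ball 0 1"
  shows "taylor_coeff (\<lambda>z. f z - g z) n = taylor_coeff f n - taylor_coeff g n"
  using taylor_coeff_fps_nth[OF has_fps_expansion_diff[OF assms[THEN has_fps_expansion_taylor]]] by simp

lemma taylor_coeff_cmult:
  assumes "f holomorphic_on ball 0 1"
  shows "taylor_coeff (\<lambda>z. c * f z) n = c * taylor_coeff f n"
  using taylor_coeff_fps_nth[OF has_fps_expansion_cmult_left[OF assms[THEN has_fps_expansion_taylor]]] by simp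

text \<open>Affine factors are the numerators \<open>z - b\<close> and denominators
  \<open>1 - cnj b * z\<close> of Moebius factors. The lemma turns a product with one of them into a
  two-term recurrence, in which the coefficient before index 0 counts as 0.\<close>

lemma taylor_coeff_affine_mult:
  assumes "f holomorphic_on ball 0 1"
  shows "taylor_coeff (\<lambda>z. (c * z + d) * f z) n =
         (if n = 0 then 0 else c * taylor_coeff f (n - 1)) + d * taylor_coeff f n"
proof -
  have "(\<lambda>z. (c * z + d) * f z) has_fps_expansion
      (fps_const c * fps_X + fps_const d) * Abs_fps (taylor_coeff f)"
    by (intro fps_expansion_intros has_fps_expansion_taylor assms)
  then have "taylor_coeff (\<lambda>z. (c * z + d) * f z) n =
      fps_nth ((fps_const c * fps_X + fps_const d) * Abs_fps (taylor_coeff f)) n"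
    by (rule taylor_coeff_fps_nth)
  also have "\<dots> = (if n = 0 then 0 else c * taylor_coeff f (n - 1)) + d * taylor_coeff f n"
    by (simp add: distrib_right mult.assoc)
  finally show ?thesis .
qed

lemma taylor_coeff_cong:
  assumes "\<And>z. z \<in> ball 0 1 \<Longrightarrow> f z = g z"
  shows "taylor_coeff f n = taylor_coeff g n"
proof -
  have "eventually (\<lambda>z. z \<in> ball 0 (1::real)) (nhds (0::complex))"
    by (intro eventually_nhds_in_open) auto
  then have "eventually (\<lambda>z. f z = g z) (nhds 0)"
    by eventually_elim (use assms in auto)
  then show ?thesis
    unfolding taylor_coeff_def by (simp add: higher_deriv_cong_ev)
qed

lemma taylor_sums:
  assumes "f holomorphic_on ball 0 1" "norm w < 1"
  shows "(\<lambda>n. taylor_coeff f n * w ^ n) sums f w"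
  using holomorphic_power_series[OF assms(1), of w] assms(2) by (simp add: taylor_coeff_def)

lemma norm_mult_le_half_squares: "norm (x * cnj y) \<le> ((cmod x)\<^sup>2 + (cmod y)\<^sup>2) / 2"
  using sum_squares_bound[of "cmod x" "cmod y"] by (simp add: norm_mult)

lemma norm_add_square_le: "(cmod (x + y))\<^sup>2 \<le> 2 * ((cmod x)\<^sup>2 + (cmod y)\<^sup>2)"
proof -
  have "(cmod (x + y))\<^sup>2 \<le> (cmod x + cmod y)\<^sup>2"
    by (intro power_mono norm_triangle_ineq) auto
  also have "\<dots> \<le> 2 * ((cmod x)\<^sup>2 + (cmod y)\<^sup>2)"
    using sum_squares_bound[of "cmod x" "cmod y"] by (simp add: power2_sum)
  finally show ?thesis .
qed

subsection \<open>The Hardy space\<close>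

text \<open>Unlike \<open>hardy2\<close>, no values are prescribed outside the disk, so that rational functions belong to it.\<close>
definition hardy_class :: "(complex \<Rightarrow> complex) set" where
  "hardy_class = {f. f holomorphic_on ball 0 1 \<and> summable (\<lambda>n. (cmod (taylor_coeff f n))\<^sup>2)}"

lemma hardy_class_holomorphic: "f \<in> hardy_class \<Longrightarrow> f holomorphic_on ball 0 1"
  by (simp add: hardy_class_def)

lemma hardy_class_summable: "f \<in> hardy_class \<Longrightarrow> summable (\<lambda>n. (cmod (taylor_coeff f n))\<^sup>2)"
  by (simp add: hardy_class_def)

lemma hardy2_subset_hardy_class: "f \<in> hardy2 \<Longrightarrow> f \<in> hardy_class"
  by (simp add: hardy2_def hardy_class_def)

lemma hardy_class_cong:
  assumes "f \<in> hardy_class" "\<And>z. z \<in> ball 0 1 \<Longrightarrow> f z = g z"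
  shows "g \<in> hardy_class"
proof -
  have "taylor_coeff g n = taylor_coeff f n" for n
    using assms(2) by (intro taylor_coeff_cong) auto
  moreover have "g holomorphic_on ball 0 1"
    using hardy_class_holomorphic[OF assms(1)] assms(2) holomorphic_transform by blast
  ultimately show ?thesis
    using assms(1) by (simp add: hardy_class_def)
qed

text \<open>The way back from \<open>hardy_class\<close> to \<open>hardy2\<close>, needed when a
  function built here has to be tested against \<open>zero_space\<close>.\<close>

lemma hardy_class_cut:
  assumes "f \<in> hardy_class"
  shows "(\<lambda>z. if z \<in> ball 0 1 then f z else 0) \<in> hardy2"
  using hardy_class_cong[OF assms, of "\<lambda>z. if z \<in> ball 0 1 then f z else 0"]
  by (simp add: hardy2_def hardy_class_def)

lemma hardy_class_cmult:
  assumes "f \<in> hardy_class"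
  shows "(\<lambda>z. c * f z) \<in> hardy_class"
  using assms
  by (auto simp: hardy_class_def taylor_coeff_cmult norm_mult power_mult_distrib
      intro!: holomorphic_intros summable_mult)

lemma hardy_class_add:
  assumes "f \<in> hardy_class" "g \<in> hardy_class"
  shows "(\<lambda>z. f z + g z) \<in> hardy_class"
proof -
  have "summable (\<lambda>n. 2 * ((cmod (taylor_coeff f n))\<^sup>2 + (cmod (taylor_coeff g n))\<^sup>2))"
    using assms by (intro summable_mult summable_add hardy_class_summable)
  then have "summable (\<lambda>n. (cmod (taylor_coeff f n + taylor_coeff g n))\<^sup>2)"
    by (rule summable_comparison_test'[where N = 0]) (simp add: norm_add_square_le del: distrib_left_numeral)
  then show ?thesis
    using assms by (auto simp: hardy_class_def taylor_coeff_add intro!: holomorphic_intros)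
qed

lemma hardy_class_diff:
  assumes "f \<in> hardy_class" "g \<in> hardy_class"
  shows "(\<lambda>z. f z - g z) \<in> hardy_class"
  using hardy_class_add[OF assms(1) hardy_class_cmult[OF assms(2), of "-1"]] by simp

lemma hardy_class_zero: "(\<lambda>_. 0) \<in> hardy_class"
  by (auto simp: hardy_class_def taylor_coeff_fps_nth[OF has_fps_expansion_0])

lemma hardy_class_sum:
  assumes "\<And>i. i \<in> I \<Longrightarrow> f i \<in> hardy_class"
  shows "(\<lambda>z. \<Sum>i\<in>I. c i * f i z) \<in> hardy_class"
  using assms
proof (induction I rule: infinite_finite_induct)
  case (insert i I)
  then show ?case
    using hardy_class_add[OF hardy_class_cmult[of "f i" "c i"]] by simp
qed (auto intro: hardy_class_zero)

lemma hardy_class_affine_mult: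
  assumes "f \<in> hardy_class"
  shows "(\<lambda>z. (c * z + d) * f z) \<in> hardy_class"
proof -
  let ?a = "taylor_coeff f"
  have hol: "f holomorphic_on ball 0 1"
    using assms by (rule hardy_class_holomorphic)
  have "summable (\<lambda>n. (cmod (if n = 0 then 0 else ?a (n - 1)))\<^sup>2)"
    using hardy_class_summable[OF assms]
    by (subst summable_Suc_iff[symmetric]) simp
  then have "summable (\<lambda>n. 2 * ((cmod c)\<^sup>2 * (cmod (if n = 0 then 0 else ?a (n - 1)))\<^sup>2 + (cmod d)\<^sup>2 * (cmod (?a n))\<^sup>2))"
    using hardy_class_summable[OF assms] by (intro summable_mult summable_add)
  then have "summable (\<lambda>n. (cmod (taylor_coeff (\<lambda>z. (c * z + d) * f z) n))\<^sup>2)"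
  proof (rule summable_comparison_test'[where N = 0])
    fix n
    have "taylor_coeff (\<lambda>z. (c * z + d) * f z) n = c * (if n = 0 then 0 else ?a (n - 1)) + d * ?a n"
      by (simp add: taylor_coeff_affine_mult[OF hol])
    then show "norm ((cmod (taylor_coeff (\<lambda>z. (c * z + d) * f z) n))\<^sup>2)
        \<le> 2 * ((cmod c)\<^sup>2 * (cmod (if n = 0 then 0 else ?a (n - 1)))\<^sup>2 + (cmod d)\<^sup>2 * (cmod (?a n))\<^sup>2)"
      using norm_add_square_le[of "c * (if n = 0 then 0 else ?a (n - 1))" "d * ?a n"]
      by (simp only: norm_mult power_mult_distrib real_norm_def abs_power2)
  qed
  then show ?thesis
    using hol by (auto simp: hardy_class_def intro!: holomorphic_intros)
qed

text \<open>Here |cnj b w| <= |b| < 1, so the pole \<open>1 / cnj b\<close> lies outside the closed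
  disk.\<close>

lemma one_minus_cnj_mult_nonzero:
  assumes "norm b < 1" "norm w \<le> 1"
  shows "1 - cnj b * w \<noteq> 0"
proof
  assume "1 - cnj b * w = 0"
  then have "norm (cnj b * w) = 1"
    by (metis eq_iff_diff_eq_0 norm_one)
  moreover have "norm (cnj b * w) \<le> norm b"
    using assms by (simp add: norm_mult mult_left_le)
  ultimately show False
    using assms by simp
qed

text \<open>The coefficients of the quotient satisfy \<open>u\<^sub>n = a\<^sub>n + cnj b * u\<^sub>n\<^sub>-\<^sub>1\<close>, so
  Minkowski's inequality bounds each partial \<open>\<ell>\<^sup>2\<close> norm by \<open>\<parallel>f\<parallel> / (1 - |b|)\<close>.\<close>
lemma hardy_class_divide:
  assumes f: "f \<in> hardy_class" and b: "norm b < 1"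
  shows "(\<lambda>z. f z / (1 - cnj b * z)) \<in> hardy_class"
proof -
  define u where "u = (\<lambda>z. f z / (1 - cnj b * z))"
  let ?a = "\<lambda>n. cmod (taylor_coeff f n)" and ?u = "\<lambda>n. cmod (taylor_coeff u n)"
  have hol: "f holomorphic_on ball 0 1"
    using f by (rule hardy_class_holomorphic)
  have nz: "1 - cnj b * z \<noteq> 0" if "z \<in> ball 0 1" for z
    using that b one_minus_cnj_mult_nonzero[of b z] by auto
  have holu: "u holomorphic_on ball 0 1"
    unfolding u_def using hol nz by (auto intro!: holomorphic_intros)
  have a: "taylor_coeff f n = (if n = 0 then 0 else - cnj b * taylor_coeff u (n - 1)) + taylor_coeff u n" for n
  proof -
    have "taylor_coeff f n = taylor_coeff (\<lambda>z. (- cnj b * z + 1) * u z) n"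
      by (intro taylor_coeff_cong) (use nz in \<open>auto simp: u_def field_simps\<close>)
    then show ?thesis
      unfolding taylor_coeff_affine_mult[OF holu] by simp
  qed
  have rec: "?u n \<le> ?a n + norm b * (if n = 0 then 0 else ?u (n - 1))" for n
  proof -
    have "taylor_coeff u n = taylor_coeff f n + cnj b * (if n = 0 then 0 else taylor_coeff u (n - 1))"
      using a[of n] by auto
    also have "cmod \<dots> \<le> ?a n + cmod (cnj b * (if n = 0 then 0 else taylor_coeff u (n - 1)))"
      by (rule norm_triangle_ineq)
    finally show ?thesis
      by (auto simp: norm_mult split: if_splits)
  qed
  have shift: "L2_set (\<lambda>n. if n = 0 then 0 else ?u (n - 1)) {..<N} \<le> L2_set ?u {..<N}" for N
  proof (cases N)
    case (Suc M)
    have "(\<Sum>n<Suc M. (if n = 0 then 0 else ?u (n - 1))\<^sup>2) = (\<Sum>n<M. (?u n)\<^sup>2)"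
      by (subst sum.lessThan_Suc_shift) simp
    also have "\<dots> \<le> (\<Sum>n<Suc M. (?u n)\<^sup>2)"
      by simp
    finally show ?thesis
      by (simp only: L2_set_def Suc real_sqrt_le_iff)
  qed simp
  have bound: "(1 - norm b) * L2_set ?u {..<N} \<le> sqrt (\<Sum>n. (?a n)\<^sup>2)" for N
  proof -
    have "L2_set ?u {..<N} \<le> L2_set (\<lambda>n. ?a n + norm b * (if n = 0 then 0 else ?u (n - 1))) {..<N}"
      by (intro L2_set_mono rec) auto
    also have "\<dots> \<le> L2_set ?a {..<N} + L2_set (\<lambda>n. norm b * (if n = 0 then 0 else ?u (n - 1))) {..<N}"
      by (rule L2_set_triangle_ineq)
    also have "L2_set (\<lambda>n. norm b * (if n = 0 then 0 else ?u (n - 1))) {..<N}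
        = norm b * L2_set (\<lambda>n. if n = 0 then 0 else ?u (n - 1)) {..<N}"
      by (rule L2_set_right_distrib[symmetric]) simp
    also have "\<dots> \<le> norm b * L2_set ?u {..<N}"
      by (intro mult_left_mono shift) simp
    also have "L2_set ?a {..<N} \<le> sqrt (\<Sum>n. (?a n)\<^sup>2)"
      unfolding L2_set_def using hardy_class_summable[OF f]
      by (intro real_sqrt_le_mono sum_le_suminf) auto
    finally show ?thesis
      by (simp add: algebra_simps)
  qed
  have "summable (\<lambda>n. (?u n)\<^sup>2)"
  proof (rule bounded_imp_summable)
    fix n
    have "L2_set ?u {..<Suc n} \<le> sqrt (\<Sum>n. (?a n)\<^sup>2) / (1 - norm b)"
      using bound[of "Suc n"] b by (simp add: field_simps)
    then have "(L2_set ?u {..<Suc n})\<^sup>2 \<le> (sqrt (\<Sum>n. (?a n)\<^sup>2) / (1 - norm b))\<^sup>2"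
      by (intro power_mono) auto
    then show "(\<Sum>k\<le>n. (?u k)\<^sup>2) \<le> (sqrt (\<Sum>n. (?a n)\<^sup>2) / (1 - norm b))\<^sup>2"
      by (simp add: L2_set_def sum_nonneg lessThan_Suc_atMost)
  qed auto
  then show ?thesis
    using holu by (simp add: hardy_class_def u_def)
qed

section \<open>Sesquilinearity of the inner product\<close>

lemma summable_mult_cnj:
  assumes "summable (\<lambda>n. (cmod (x n))\<^sup>2)" "summable (\<lambda>n. (cmod (y n))\<^sup>2)"
  shows "summable (\<lambda>n. x n * cnj (y n))"
proof -
  have "summable (\<lambda>n. ((cmod (x n))\<^sup>2 + (cmod (y n))\<^sup>2) / 2)"
    using assms by (intro summable_divide summable_add)
  then show ?thesis
    by (rule summable_comparison_test'[where N = 0]) (rule norm_mult_le_half_squares)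
qed

lemma hardy_class_inner_summable:
  assumes "f \<in> hardy_class" "g \<in> hardy_class"
  shows "summable (\<lambda>n. taylor_coeff f n * cnj (taylor_coeff g n))"
  using assms by (intro summable_mult_cnj hardy_class_summable)

lemma hardy2_inner_diff_left:
  assumes "f \<in> hardy_class" "g \<in> hardy_class" "h \<in> hardy_class"
  shows "hardy2_inner (\<lambda>z. f z - g z) h = hardy2_inner f h - hardy2_inner g h"
  unfolding hardy2_inner_def
  using suminf_diff[OF hardy_class_inner_summable[OF assms(1,3)] hardy_class_inner_summable[OF assms(2,3)]]
  by (simp add: taylor_coeff_diff hardy_class_holomorphic assms left_diff_distrib)

lemma hardy2_inner_add_left:
  assumes "f \<in> hardy_class" "g \<in> hardy_class" "h \<in> hardy_class"
  shows "hardy2_inner (\<lambda>z. f z + g z) h = hardy2_inner f h + hardy2_inner g h"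
  unfolding hardy2_inner_def
  using suminf_add[OF hardy_class_inner_summable[OF assms(1,3)] hardy_class_inner_summable[OF assms(2,3)]]
  by (simp add: taylor_coeff_add hardy_class_holomorphic assms distrib_right)

lemma hardy2_inner_cmult_left:
  assumes "f \<in> hardy_class" "h \<in> hardy_class"
  shows "hardy2_inner (\<lambda>z. c * f z) h = c * hardy2_inner f h"
  unfolding hardy2_inner_def
  using suminf_mult[OF hardy_class_inner_summable[OF assms], of c]
  by (simp add: taylor_coeff_cmult hardy_class_holomorphic assms mult.assoc)

lemma hardy2_inner_commute:
  assumes "f \<in> hardy_class" "g \<in> hardy_class"
  shows "hardy2_inner g f = cnj (hardy2_inner f g)"
proof -
  have "(\<lambda>n. cnj (taylor_coeff f n * cnj (taylor_coeff g n))) sums cnj (hardy2_inner f g)"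
    unfolding sums_cnj hardy2_inner_def
    using hardy_class_inner_summable[OF assms] by (rule summable_sums)
  then have "(\<lambda>n. taylor_coeff g n * cnj (taylor_coeff f n)) sums cnj (hardy2_inner f g)"
    by (simp add: mult.commute)
  then show ?thesis
    by (simp add: hardy2_inner_def sums_iff)
qed

lemma hardy2_inner_zero_left: "hardy2_inner (\<lambda>_. 0) h = 0"
  by (simp add: hardy2_inner_def taylor_coeff_fps_nth[OF has_fps_expansion_0])

lemma hardy2_inner_sum_left:
  assumes "\<And>i. i \<in> I \<Longrightarrow> f i \<in> hardy_class" "h \<in> hardy_class"
  shows "hardy2_inner (\<lambda>z. \<Sum>i\<in>I. c i * f i z) h = (\<Sum>i\<in>I. c i * hardy2_inner (f i) h)"
  using assms
proof (induction I rule: infinite_finite_induct)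
  case (insert i I)
  have "hardy2_inner (\<lambda>z. c i * f i z + (\<Sum>i\<in>I. c i * f i z)) h =
      hardy2_inner (\<lambda>z. c i * f i z) h + hardy2_inner (\<lambda>z. \<Sum>i\<in>I. c i * f i z) h"
    using insert.prems by (intro hardy2_inner_add_left hardy_class_cmult hardy_class_sum) auto
  then show ?case
    using insert by (simp add: hardy2_inner_cmult_left)
qed (auto simp: hardy2_inner_zero_left)

lemma hardy2_inner_diff_right:
  assumes "f \<in> hardy_class" "g \<in> hardy_class" "h \<in> hardy_class"
  shows "hardy2_inner h (\<lambda>z. f z - g z) = hardy2_inner h f - hardy2_inner h g"
  using assms hardy2_inner_diff_left[OF assms]
  by (simp add: hardy2_inner_commute[of _ h] hardy_class_diff)

lemma hardy2_inner_cmult_right: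
  assumes "f \<in> hardy_class" "h \<in> hardy_class"
  shows "hardy2_inner h (\<lambda>z. c * f z) = cnj c * hardy2_inner h f"
  using assms hardy2_inner_cmult_left[OF assms]
  by (simp add: hardy2_inner_commute[of _ h] hardy_class_cmult)

section \<open>The norm, Cauchy-Schwarz and weak convergence\<close>

definition hardy_norm2 :: "(complex \<Rightarrow> complex) \<Rightarrow> real" where
  "hardy_norm2 f = (\<Sum>n. (cmod (taylor_coeff f n))\<^sup>2)"

lemma hardy2_inner_self:
  assumes "f \<in> hardy_class"
  shows "hardy2_inner f f = of_real (hardy_norm2 f)"
  unfolding hardy2_inner_def hardy_norm2_def
  using suminf_of_real[OF hardy_class_summable[OF assms], where ?'a = complex]
  by (simp add: complex_norm_square del: of_real_power)

lemma hardy_norm2_nonneg: "f \<in> hardy_class \<Longrightarrow> 0 \<le> hardy_norm2 f"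
  unfolding hardy_norm2_def by (intro suminf_nonneg hardy_class_summable) auto

text \<open>The finite inequality for \<open>L2_set\<close> bounds all partial sums by the same
  constant, and the bound passes to the limit.\<close>

lemma Cauchy_Schwarz_suminf:
  assumes x: "summable (\<lambda>n. (cmod (x n))\<^sup>2)" and y: "summable (\<lambda>n. (cmod (y n))\<^sup>2)"
  shows "(cmod (\<Sum>n. x n * cnj (y n)))\<^sup>2 \<le> (\<Sum>n. (cmod (x n))\<^sup>2) * (\<Sum>n. (cmod (y n))\<^sup>2)"
proof -
  have "summable (\<lambda>n. x n * cnj (y n))"
    using x y by (rule summable_mult_cnj)
  then have "(\<lambda>N. (cmod (\<Sum>n<N. x n * cnj (y n)))\<^sup>2) \<longlonglongrightarrow> (cmod (\<Sum>n. x n * cnj (y n)))\<^sup>2"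
    by (intro tendsto_intros summable_LIMSEQ)
  moreover have "(cmod (\<Sum>n<N. x n * cnj (y n)))\<^sup>2 \<le> (\<Sum>n. (cmod (x n))\<^sup>2) * (\<Sum>n. (cmod (y n))\<^sup>2)" for N
  proof -
    have "cmod (\<Sum>n<N. x n * cnj (y n)) \<le> (\<Sum>n<N. \<bar>cmod (x n)\<bar> * \<bar>cmod (y n)\<bar>)"
      by (rule order_trans[OF norm_sum]) (simp add: norm_mult)
    also have "\<dots> \<le> L2_set (\<lambda>n. cmod (x n)) {..<N} * L2_set (\<lambda>n. cmod (y n)) {..<N}"
      by (rule L2_set_mult_ineq)
    finally have "(cmod (\<Sum>n<N. x n * cnj (y n)))\<^sup>2 \<le>
        (L2_set (\<lambda>n. cmod (x n)) {..<N} * L2_set (\<lambda>n. cmod (y n)) {..<N})\<^sup>2"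
      by (intro power_mono) auto
    also have "\<dots> = (\<Sum>n<N. (cmod (x n))\<^sup>2) * (\<Sum>n<N. (cmod (y n))\<^sup>2)"
      unfolding power_mult_distrib by (simp add: L2_set_def sum_nonneg)
    also have "\<dots> \<le> (\<Sum>n. (cmod (x n))\<^sup>2) * (\<Sum>n. (cmod (y n))\<^sup>2)"
      using x y by (intro mult_mono sum_le_suminf suminf_nonneg sum_nonneg) auto
    finally show ?thesis .
  qed
  ultimately show ?thesis
    by (intro LIMSEQ_le_const2) auto
qed

lemma hardy2_inner_Cauchy_Schwarz:
  assumes "f \<in> hardy_class" "g \<in> hardy_class"
  shows "(cmod (hardy2_inner f g))\<^sup>2 \<le> hardy_norm2 f * hardy_norm2 g"
  unfolding hardy2_inner_def hardy_norm2_def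
  using assms by (intro Cauchy_Schwarz_suminf hardy_class_summable)

text \<open>Norm-bounded sequences that tend to 0 in each coordinate tend to 0 weakly.
  Cauchy-Schwarz makes the tail of the pairing small uniformly in \<open>N\<close>, because
  \<open>x\<close> has a small tail; the head is a finite sum of null sequences.\<close>

lemma l2_weak_convergence_zero:
  assumes x: "summable (\<lambda>n. (cmod (x n))\<^sup>2)"
    and d: "\<And>N. summable (\<lambda>n. (cmod (d N n))\<^sup>2)"
    and bound: "\<And>N. (\<Sum>n. (cmod (d N n))\<^sup>2) \<le> D"
    and lim: "\<And>n. (\<lambda>N. d N n) \<longlonglongrightarrow> 0"
  shows "(\<lambda>N. \<Sum>n. x n * cnj (d N n)) \<longlonglongrightarrow> 0"
proof (rule LIMSEQ_I)
  fix e :: real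
  assume e: "0 < e"
  have D: "0 \<le> D"
    using order_trans[OF suminf_nonneg[OF d] bound] by simp
  \<comment> \<open>The threshold is chosen so that, multiplied by the bound \<open>D + 1\<close>,
    it gives \<open>(e / 2)^2\<close>. Using \<open>D + 1\<close> keeps the denominator positive
    when \<open>D = 0\<close>.\<close>
  obtain K where K: "\<And>n. n \<ge> K \<Longrightarrow> norm (\<Sum>i. (cmod (x (i + n)))\<^sup>2) < e\<^sup>2 / (4 * (D + 1))"
    using suminf_exist_split[of "e\<^sup>2 / (4 * (D + 1))", OF _ x] e D by (auto simp: power2_eq_square)
  have "(\<lambda>N. \<Sum>n<K. x n * cnj (d N n)) \<longlonglongrightarrow> (\<Sum>n<K. x n * cnj 0)"
    by (intro tendsto_intros lim)
  then obtain N0 where N0: "\<And>N. N \<ge> N0 \<Longrightarrow> norm (\<Sum>n<K. x n * cnj (d N n)) < e / 2"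
    using LIMSEQ_D[of _ 0 "e / 2"] e by auto
  have "norm (\<Sum>n. x n * cnj (d N n)) < e" if N: "N \<ge> N0" for N
  proof -
    have tail: "norm (\<Sum>n. x (n + K) * cnj (d N (n + K))) \<le> e / 2"
    proof (rule power2_le_imp_le)
      have xK: "summable (\<lambda>n. (cmod (x (n + K)))\<^sup>2)" and dK: "summable (\<lambda>n. (cmod (d N (n + K)))\<^sup>2)"
        using summable_ignore_initial_segment[OF x, of K] summable_ignore_initial_segment[OF d[of N], of K]
        by auto
      have "(norm (\<Sum>n. x (n + K) * cnj (d N (n + K))))\<^sup>2 \<le>
          (\<Sum>n. (cmod (x (n + K)))\<^sup>2) * (\<Sum>n. (cmod (d N (n + K)))\<^sup>2)"
        using xK dK by (rule Cauchy_Schwarz_suminf)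
      also have "\<dots> \<le> e\<^sup>2 / (4 * (D + 1)) * (D + 1)"
      proof (rule mult_mono)
        show "(\<Sum>n. (cmod (x (n + K)))\<^sup>2) \<le> e\<^sup>2 / (4 * (D + 1))"
          using K[of K] by simp
        have "(\<Sum>n. (cmod (d N (n + K)))\<^sup>2) \<le> (\<Sum>n. (cmod (d N n))\<^sup>2)"
          using suminf_split_initial_segment[OF d[of N], of K] sum_nonneg[of "{..<K}" "\<lambda>n. (cmod (d N n))\<^sup>2"]
          by simp
        then show "(\<Sum>n. (cmod (d N (n + K)))\<^sup>2) \<le> D + 1"
          using bound[of N] by simp
      qed (use D dK in \<open>auto intro!: suminf_nonneg\<close>)
      also have "\<dots> = (e / 2)\<^sup>2"
        using D by (simp add: power2_eq_square field_simps)
      finally show "(norm (\<Sum>n. x (n + K) * cnj (d N (n + K))))\<^sup>2 \<le> (e / 2)\<^sup>2" .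
    qed (use e in auto)
    have "(\<Sum>n. x n * cnj (d N n)) = (\<Sum>n. x (n + K) * cnj (d N (n + K))) + (\<Sum>n<K. x n * cnj (d N n))"
      using x d by (intro suminf_split_initial_segment summable_mult_cnj)
    then have "norm (\<Sum>n. x n * cnj (d N n)) \<le>
        norm (\<Sum>n. x (n + K) * cnj (d N (n + K))) + norm (\<Sum>n<K. x n * cnj (d N n))"
      by (simp add: norm_triangle_ineq)
    then show ?thesis
      using tail N0[OF N] by linarith
  qed
  then show "\<exists>N0. \<forall>N\<ge>N0. norm ((\<Sum>n. x n * cnj (d N n)) - 0) < e"
    by auto
qed

subsection \<open>Szego kernel and Moebius factors\<close>

definition szego_kernel :: "complex \<Rightarrow> complex \<Rightarrow> complex" where
  "szego_kernel b z = 1 / (1 - cnj b * z)"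

lemma hardy_class_one: "(\<lambda>_. 1) \<in> hardy_class"
proof -
  have "taylor_coeff (\<lambda>_. 1) n = (if n = 0 then 1 else 0)" for n
    by (simp add: taylor_coeff_fps_nth[OF has_fps_expansion_1])
  then have "summable (\<lambda>n. (cmod (taylor_coeff (\<lambda>_. 1) n))\<^sup>2)"
    by (intro summable_finite[of "{0}"]) auto
  then show ?thesis
    by (simp add: hardy_class_def)
qed

lemma szego_kernel_hardy: "norm b < 1 \<Longrightarrow> szego_kernel b \<in> hardy_class"
  unfolding szego_kernel_def[abs_def] by (rule hardy_class_divide[OF hardy_class_one])

text \<open>Comparing coefficients in \<open>(1 - cnj b * z) * szego_kernel b z = 1\<close> gives a
  geometric recurrence.\<close>

lemma taylor_coeff_szego_kernel:
  assumes "norm b < 1"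
  shows "taylor_coeff (szego_kernel b) n = cnj b ^ n"
proof -
  let ?k = "szego_kernel b"
  have hol: "?k holomorphic_on ball 0 1"
    using szego_kernel_hardy[OF assms] by (rule hardy_class_holomorphic)
  have *: "taylor_coeff (\<lambda>_. 1) n = (if n = 0 then 0 else - cnj b * taylor_coeff ?k (n - 1)) + taylor_coeff ?k n" for n
  proof -
    have "taylor_coeff (\<lambda>_. 1) n = taylor_coeff (\<lambda>z. (- cnj b * z + 1) * ?k z) n"
      using assms one_minus_cnj_mult_nonzero[of b]
      by (intro taylor_coeff_cong) (auto simp: szego_kernel_def field_simps)
    then show ?thesis
      unfolding taylor_coeff_affine_mult[OF hol] by simp
  qed
  have one: "taylor_coeff (\<lambda>_. 1) n = (if n = 0 then 1 else 0)" for n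
    by (simp add: taylor_coeff_fps_nth[OF has_fps_expansion_1])
  show ?thesis
  proof (induction n)
    case 0
    show ?case using *[of 0] one[of 0] by simp
  next
    case (Suc n)
    have "taylor_coeff ?k (Suc n) = cnj b * taylor_coeff ?k n"
      using *[of "Suc n"] one[of "Suc n"] by (simp add: eq_neg_iff_add_eq_0)
    then show ?case
      using Suc by simp
  qed
qed

text \<open>The reproducing property: pairing with the coefficients \<open>cnj b ^ n\<close> sums
  the Taylor series of \<open>f\<close> at \<open>b\<close>.\<close>

lemma hardy2_inner_szego:
  assumes "f \<in> hardy_class" "norm b < 1"
  shows "hardy2_inner f (szego_kernel b) = f b"
  unfolding hardy2_inner_def
  using sums_unique[OF taylor_sums[OF hardy_class_holomorphic[OF assms(1)] assms(2)]] assms(2)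
  by (simp add: taylor_coeff_szego_kernel)

text \<open>The reproducing property applied to the kernel itself.\<close>

lemma hardy_norm2_szego:
  assumes "norm w < 1"
  shows "hardy_norm2 (szego_kernel w) = 1 / (1 - (cmod w)\<^sup>2)"
proof -
  have "complex_of_real (hardy_norm2 (szego_kernel w)) = of_real (1 / (1 - (cmod w)\<^sup>2))"
    using assms
    by (subst hardy2_inner_self[symmetric])
       (simp_all add: hardy2_inner_szego szego_kernel_hardy szego_kernel_def complex_norm_square
         mult.commute del: of_real_power)
  then show ?thesis
    by (simp only: of_real_eq_iff)
qed

text \<open>Cauchy-Schwarz against the kernel at \<open>w\<close>. It turns convergence in norm into
  pointwise convergence in the disk.\<close>

lemma norm_square_le_hardy_norm2:
  assumes "f \<in> hardy_class" "norm w < 1"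
  shows "(cmod (f w))\<^sup>2 \<le> hardy_norm2 f / (1 - (cmod w)\<^sup>2)"
  using hardy2_inner_Cauchy_Schwarz[OF assms(1) szego_kernel_hardy[OF assms(2)]] assms
  by (simp add: hardy2_inner_szego hardy_norm2_szego)

text \<open>With \<open>v = u / (1 - cnj b z)\<close> the two sides are the inner products of \<open>(z - b) v\<close> and of
  \<open>(1 - cnj b z) v\<close>; the difference of the coefficient sums telescopes to
  \<open>- (1 - |b|\<^sup>2) v\<^sub>N cnj v'\<^sub>N\<close>.\<close>
lemma hardy2_inner_Moebius_mult:
  assumes u: "u \<in> hardy_class" and u': "u' \<in> hardy_class" and b: "norm b < 1"
  shows "hardy2_inner (\<lambda>z. Moebius_function 0 b z * u z) (\<lambda>z. Moebius_function 0 b z * u' z) = hardy2_inner u u'"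
proof -
  define v v' where "v = (\<lambda>z. u z / (1 - cnj b * z))" and "v' = (\<lambda>z. u' z / (1 - cnj b * z))"
  have v: "v \<in> hardy_class" and v': "v' \<in> hardy_class"
    unfolding v_def v'_def using hardy_class_divide u u' b by auto
  have hol: "v holomorphic_on ball 0 1" "v' holomorphic_on ball 0 1"
    using v v' by (auto intro: hardy_class_holomorphic)
  \<comment> \<open>The factors are spelled \<open>1 * z + - b\<close> and
    \<open>- cnj b * z + 1\<close> to match the pattern of
    \<open>taylor_coeff_affine_mult\<close>.\<close>
  define p q p' q' where "p = taylor_coeff (\<lambda>z. (1 * z + - b) * v z)"
    and "q = taylor_coeff (\<lambda>z. (- cnj b * z + 1) * v z)"
    and "p' = taylor_coeff (\<lambda>z. (1 * z + - b) * v' z)"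
    and "q' = taylor_coeff (\<lambda>z. (- cnj b * z + 1) * v' z)"
  note pq = p_def q_def p'_def q'_def
  have eqs: "taylor_coeff (\<lambda>z. Moebius_function 0 b z * u z) = p" "taylor_coeff u = q"
     "taylor_coeff (\<lambda>z. Moebius_function 0 b z * u' z) = p'" "taylor_coeff u' = q'"
    unfolding pq using one_minus_cnj_mult_nonzero[OF b]
    by (auto intro!: ext taylor_coeff_cong simp: Moebius_function_simple v_def v'_def field_simps)
  have summ: "summable (\<lambda>n. p n * cnj (p' n))" "summable (\<lambda>n. q n * cnj (q' n))"
    unfolding pq by (intro hardy_class_inner_summable hardy_class_affine_mult v v')+
  let ?a = "taylor_coeff v" and ?c = "taylor_coeff v'"
  have coeff: "p n = (if n = 0 then 0 else ?a (n - 1)) - b * ?a n"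
     "q n = ?a n - cnj b * (if n = 0 then 0 else ?a (n - 1))"
     "p' n = (if n = 0 then 0 else ?c (n - 1)) - b * ?c n"
     "q' n = ?c n - cnj b * (if n = 0 then 0 else ?c (n - 1))" for n
    unfolding pq taylor_coeff_affine_mult[OF hol(1)] taylor_coeff_affine_mult[OF hol(2)] by auto
  have tele: "(\<Sum>n<Suc N. p n * cnj (p' n) - q n * cnj (q' n)) = - ((1 - b * cnj b) * (?a N * cnj (?c N)))" for N
  proof (induction N)
    case 0
    show ?case by (simp add: coeff algebra_simps)
  next
    case (Suc N)
    show ?case
      by (subst sum.lessThan_Suc, subst Suc) (simp add: coeff algebra_simps)
  qed
  have "(\<lambda>N. ?a N * cnj (?c N)) \<longlonglongrightarrow> 0"
    using hardy_class_inner_summable[OF v v'] by (rule summable_LIMSEQ_zero)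
  then have "(\<lambda>N. - ((1 - b * cnj b) * (?a N * cnj (?c N)))) \<longlonglongrightarrow> - ((1 - b * cnj b) * 0)"
    by (intro tendsto_intros)
  then have "(\<lambda>N. \<Sum>n<Suc N. p n * cnj (p' n) - q n * cnj (q' n)) \<longlonglongrightarrow> 0"
    by (simp only: tele) simp
  moreover have "(\<lambda>N. \<Sum>n<Suc N. p n * cnj (p' n) - q n * cnj (q' n)) \<longlonglongrightarrow>
      (\<Sum>n. p n * cnj (p' n)) - (\<Sum>n. q n * cnj (q' n))"
    using LIMSEQ_Suc[OF sums_diff[OF summable_sums[OF summ(1)] summable_sums[OF summ(2)], unfolded sums_def]] .
  ultimately have "(\<Sum>n. p n * cnj (p' n)) = (\<Sum>n. q n * cnj (q' n))"
    using LIMSEQ_unique by fastforce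
  then show ?thesis
    unfolding hardy2_inner_def eqs .
qed

lemma hardy_class_Moebius_mult:
  assumes u: "u \<in> hardy_class" and b: "norm b < 1"
  shows "(\<lambda>z. Moebius_function 0 b z * u z) \<in> hardy_class"
  using hardy_class_affine_mult[OF hardy_class_divide[OF u b], of 1 "- b"]
  by (simp add: Moebius_function_simple)

lemma hardy2_inner_cong:
  assumes "\<And>z. z \<in> ball 0 1 \<Longrightarrow> f z = f' z" "\<And>z. z \<in> ball 0 1 \<Longrightarrow> g z = g' z"
  shows "hardy2_inner f g = hardy2_inner f' g'"
proof -
  have "taylor_coeff f = taylor_coeff f'" "taylor_coeff g = taylor_coeff g'"
    using assms by (auto intro!: ext taylor_coeff_cong)
  then show ?thesis
    by (simp add: hardy2_inner_def)
qed

text \<open>With the denominator cleared this is |w - b|^2 = |1 - cnj b w|^2 + (|w|^2 - 1)(1 -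
  |b|^2). It also holds outside the disk, where it controls how far the modulus of a factor exceeds
  1.\<close>

lemma norm_Moebius_square:
  assumes "1 - cnj b * w \<noteq> 0"
  shows "(cmod (Moebius_function 0 b w))\<^sup>2 =
    1 + ((cmod w)\<^sup>2 - 1) * (1 - (cmod b)\<^sup>2) / (cmod (1 - cnj b * w))\<^sup>2"
proof -
  have "complex_of_real ((cmod (w - b))\<^sup>2) =
      of_real ((cmod (1 - cnj b * w))\<^sup>2 + ((cmod w)\<^sup>2 - 1) * (1 - (cmod b)\<^sup>2))"
    unfolding of_real_add of_real_mult of_real_diff complex_norm_square
    by (simp add: algebra_simps)
  then have "(cmod (w - b))\<^sup>2 = (cmod (1 - cnj b * w))\<^sup>2 + ((cmod w)\<^sup>2 - 1) * (1 - (cmod b)\<^sup>2)"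
    by (simp only: of_real_eq_iff)
  then show ?thesis
    using assms by (simp add: Moebius_function_simple norm_divide power_divide add_divide_distrib)
qed

subsection \<open>The Takenaka--Malmquist system\<close>

locale takenaka_malmquist =
  fixes b :: "nat \<Rightarrow> complex"
  assumes norm_b: "norm (b j) < 1"
begin

text \<open>Indexed by a set, so that \<open>{..<j}\<close> can be split at an index
  \<open>i\<close>. Only finite products occur, hence the factors carry no unimodular
  normalisation.\<close>

definition blaschke_prod :: "nat set \<Rightarrow> complex \<Rightarrow> complex" where
  "blaschke_prod S z = (\<Prod>i\<in>S. Moebius_function 0 (b i) z)"

definition tm_basis :: "nat \<Rightarrow> complex \<Rightarrow> complex" where
  "tm_basis j z = of_real (sqrt (1 - (cmod (b j))\<^sup>2)) * (blaschke_prod {..<j} z * szego_kernel (b j) z)"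

lemma one_minus_norm_b_square: "0 < 1 - (cmod (b j))\<^sup>2"
  using norm_b[of j] by (simp add: abs_square_less_1)

lemma blaschke_prod_mult_hardy:
  assumes "finite S" "u \<in> hardy_class"
  shows "(\<lambda>z. blaschke_prod S z * u z) \<in> hardy_class"
  using assms
proof (induction S)
  case (insert i S)
  then show ?case
    using hardy_class_Moebius_mult[OF insert.IH norm_b[of i]] by (simp add: blaschke_prod_def mult.assoc)
qed (simp add: blaschke_prod_def)

text \<open>Each Moebius factor acts isometrically, so induction adds them one at a time.\<close>

lemma blaschke_prod_mult_inner:
  assumes "finite S" "u \<in> hardy_class" "v \<in> hardy_class"
  shows "hardy2_inner (\<lambda>z. blaschke_prod S z * u z) (\<lambda>z. blaschke_prod S z * v z) = hardy2_inner u v"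
  using assms
proof (induction S)
  case (insert i S)
  then show ?case
    using hardy2_inner_Moebius_mult[OF blaschke_prod_mult_hardy[OF insert.hyps(1) insert.prems(1)]
        blaschke_prod_mult_hardy[OF insert.hyps(1) insert.prems(2)] norm_b[of i]]
    by (simp add: blaschke_prod_def mult.assoc)
qed (simp add: blaschke_prod_def)

lemma tm_basis_hardy: "tm_basis j \<in> hardy_class"
  unfolding tm_basis_def[abs_def]
  by (intro hardy_class_cmult blaschke_prod_mult_hardy szego_kernel_hardy norm_b) simp

text \<open>The common factor \<open>blaschke_prod {..<i}\<close> cancels by isometry. What remains
  is a function \<open>h\<close> paired with the kernel at \<open>b i\<close>, that is
  \<open>h (b i)\<close>, and this is 0 since \<open>h\<close> contains the Moebius factor of
  \<open>b i\<close>.\<close>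

lemma tm_basis_inner_less:
  assumes "i < j"
  shows "hardy2_inner (tm_basis j) (tm_basis i) = 0"
proof -
  define h where "h = (\<lambda>z. Moebius_function 0 (b i) z * (blaschke_prod {i<..<j} z * szego_kernel (b j) z))"
  have h: "h \<in> hardy_class"
    unfolding h_def by (intro hardy_class_Moebius_mult blaschke_prod_mult_hardy szego_kernel_hardy norm_b) simp
  have "{..<j} = {..<i} \<union> insert i {i<..<j}"
    using assms by auto
  then have "blaschke_prod {..<j} z = blaschke_prod {..<i} z * (Moebius_function 0 (b i) z * blaschke_prod {i<..<j} z)" for z
    unfolding blaschke_prod_def by (simp only:) (subst prod.union_disjoint; force)
  then have "tm_basis j = (\<lambda>z. of_real (sqrt (1 - (cmod (b j))\<^sup>2)) * (blaschke_prod {..<i} z * h z))"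
    by (simp add: tm_basis_def[abs_def] h_def mult.assoc)
  moreover have "hardy2_inner (\<lambda>z. blaschke_prod {..<i} z * h z) (\<lambda>z. blaschke_prod {..<i} z * szego_kernel (b i) z) = 0"
    by (subst blaschke_prod_mult_inner)
       (simp_all add: h szego_kernel_hardy norm_b hardy2_inner_szego, simp add: h_def Moebius_function_eq_zero)
  moreover have "tm_basis i = (\<lambda>z. of_real (sqrt (1 - (cmod (b i))\<^sup>2)) * (blaschke_prod {..<i} z * szego_kernel (b i) z))"
    by (simp add: tm_basis_def[abs_def])
  ultimately show ?thesis
    by (simp add: hardy2_inner_cmult_left hardy2_inner_cmult_right blaschke_prod_mult_hardy h
        szego_kernel_hardy norm_b hardy_class_cmult)
qed

lemma tm_basis_inner: "hardy2_inner (tm_basis i) (tm_basis j) = (if i = j then 1 else 0)"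
proof -
  consider "i < j" | "j < i" | "i = j" by linarith
  then show ?thesis
  proof cases
    case 1
    then show ?thesis
      using tm_basis_inner_less[of i j] hardy2_inner_commute[OF tm_basis_hardy[of j] tm_basis_hardy[of i]] by simp
  next
    case 2
    then show ?thesis
      using tm_basis_inner_less[of j i] by simp
  next
    case 3
    let ?s = "sqrt (1 - (cmod (b j))\<^sup>2)"
    have "hardy2_inner (tm_basis j) (tm_basis j) = of_real ?s * (of_real ?s * (1 / (1 - cnj (b j) * b j)))"
      unfolding tm_basis_def[abs_def]
      by (simp add: hardy2_inner_cmult_left hardy2_inner_cmult_right blaschke_prod_mult_hardy
        blaschke_prod_mult_inner szego_kernel_hardy norm_b hardy_class_cmult hardy2_inner_szego)
         (simp add: szego_kernel_def)
    also have "cnj (b j) * b j = of_real ((cmod (b j))\<^sup>2)"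
      by (simp only: complex_norm_square mult.commute)
    also have "of_real ?s * (of_real ?s * (1 / (1 - complex_of_real ((cmod (b j))\<^sup>2)))) =
        of_real (?s * ?s / (1 - (cmod (b j))\<^sup>2))"
      by (simp only: of_real_divide of_real_mult of_real_diff of_real_1 times_divide_eq_right mult_1_right)
    also have "\<dots> = 1"
      using one_minus_norm_b_square[of j] by simp
    finally show ?thesis
      using 3 by simp
  qed
qed

text \<open>A Christoffel-Darboux formula. If \<open>w\<close> is one of the first \<open>N\<close>
  points, the last term vanishes and the kernel at \<open>w\<close> is a combination of the first
  \<open>N\<close> basis functions.\<close>

lemma szego_kernel_expansion:
  assumes w: "norm w < 1" and z: "norm z < 1"
  shows "szego_kernel w z = (\<Sum>j<N. cnj (tm_basis j w) * tm_basis j z)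
    + cnj (blaschke_prod {..<N} w) * blaschke_prod {..<N} z * szego_kernel w z"
proof (induction N)
  case 0
  show ?case by (simp add: blaschke_prod_def)
next
  case (Suc N)
  let ?P = "blaschke_prod {..<N}" and ?M = "Moebius_function 0 (b N)" and ?k = "szego_kernel (b N)"
  have P: "blaschke_prod {..<Suc N} z = ?P z * ?M z" for z
    by (simp add: blaschke_prod_def)
  have nz: "1 - cnj (b N) * z \<noteq> 0" "1 - b N * cnj w \<noteq> 0" "1 - cnj w * z \<noteq> 0"
    using one_minus_cnj_mult_nonzero[OF norm_b[of N], of z] one_minus_cnj_mult_nonzero[of w z] w z
      one_minus_cnj_mult_nonzero[of "cnj (b N)" "cnj w"] norm_b[of N] by auto
  have s: "complex_of_real (sqrt (1 - (cmod (b N))\<^sup>2)) * of_real (sqrt (1 - (cmod (b N))\<^sup>2)) = 1 - b N * cnj (b N)"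
    using one_minus_norm_b_square[of N]
    by (simp flip: of_real_mult complex_norm_square)
  \<comment> \<open>This is the polarised form of \<open>norm_Moebius_square\<close>, divided by
    \<open>1 - cnj w * z\<close>. Multiplied by \<open>cnj (?P w) * ?P z\<close> it gives the new
    summand.\<close>
  have "szego_kernel w z - cnj (?M w) * ?M z * szego_kernel w z = (1 - b N * cnj (b N)) * (cnj (?k w) * ?k z)"
    using nz by (simp add: szego_kernel_def Moebius_function_simple divide_simps) (simp add: algebra_simps)
  then have "cnj (?P w) * ?P z * szego_kernel w z - cnj (?P w * ?M w) * (?P z * ?M z) * szego_kernel w z
      = cnj (?P w) * ?P z * ((1 - b N * cnj (b N)) * (cnj (?k w) * ?k z))"
    by (subst \<open>_ = (1 - b N * cnj (b N)) * _\<close>[symmetric]) (simp add: algebra_simps)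
  also have "\<dots> = cnj (tm_basis N w) * tm_basis N z"
    unfolding tm_basis_def s[symmetric] by simp
  finally show ?case
    using Suc unfolding P by (simp add: algebra_simps)
qed

section \<open>Fourier remainders and Bessel's inequality\<close>

definition remainder :: "(complex \<Rightarrow> complex) \<Rightarrow> nat \<Rightarrow> complex \<Rightarrow> complex" where
  "remainder f N z = f z - (\<Sum>j<N. hardy2_inner f (tm_basis j) * tm_basis j z)"

lemma remainder_hardy: "f \<in> hardy_class \<Longrightarrow> remainder f N \<in> hardy_class"
  unfolding remainder_def[abs_def] by (intro hardy_class_diff hardy_class_sum tm_basis_hardy)

lemma remainder_inner_tm:
  assumes "f \<in> hardy_class" "i < N"
  shows "hardy2_inner (remainder f N) (tm_basis i) = 0"
  unfolding remainder_def[abs_def] using assms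
  by (simp add: hardy2_inner_diff_left hardy2_inner_sum_left hardy_class_sum tm_basis_hardy tm_basis_inner if_distrib cong: if_cong)

text \<open>The kernel at \<open>b i\<close> lies in the span of the first \<open>N\<close> basis
  functions, and the remainder is orthogonal to that span. The reproducing property reads this as a
  value.\<close>

lemma remainder_zero:
  assumes f: "f \<in> hardy_class" and i: "i < N"
  shows "remainder f N (b i) = 0"
proof -
  let ?R = "remainder f N"
  have R: "?R \<in> hardy_class"
    using f by (rule remainder_hardy)
  have "blaschke_prod {..<N} (b i) = 0"
    using i unfolding blaschke_prod_def by (intro prod_zero) (auto intro: Moebius_function_eq_zero)
  then have k: "szego_kernel (b i) z = (\<Sum>j<N. cnj (tm_basis j (b i)) * tm_basis j z)" if "z \<in> ball 0 1" for z
    using szego_kernel_expansion[OF norm_b, of z i N] that by simp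
  have "hardy2_inner (\<lambda>z. \<Sum>j<N. cnj (tm_basis j (b i)) * tm_basis j z) ?R = 0"
    using R remainder_inner_tm[OF f]
    by (simp add: hardy2_inner_sum_left tm_basis_hardy hardy2_inner_commute[OF R tm_basis_hardy])
  moreover have "hardy2_inner (szego_kernel (b i)) ?R = hardy2_inner (\<lambda>z. \<Sum>j<N. cnj (tm_basis j (b i)) * tm_basis j z) ?R"
    by (rule hardy2_inner_cong) (simp_all only: k)
  ultimately have "hardy2_inner (szego_kernel (b i)) ?R = 0"
    by simp
  then have "hardy2_inner ?R (szego_kernel (b i)) = 0"
    by (subst hardy2_inner_commute[OF szego_kernel_hardy[OF norm_b] R]) simp
  then show ?thesis
    by (simp add: hardy2_inner_szego R norm_b)
qed

text \<open>The subtracted sum is the orthogonal projection of \<open>f\<close>, which pairs to 0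
  with the remainder; so \<open>f\<close> may be replaced by the remainder in the first
  slot.\<close>

lemma inner_remainder:
  assumes f: "f \<in> hardy_class"
  shows "hardy2_inner f (remainder f N) = of_real (hardy_norm2 (remainder f N))"
proof -
  let ?R = "remainder f N" and ?S = "\<lambda>z. \<Sum>j<N. hardy2_inner f (tm_basis j) * tm_basis j z"
  have R: "?R \<in> hardy_class"
    using f by (rule remainder_hardy)
  have "hardy2_inner ?S ?R = 0"
    using remainder_inner_tm[OF f]
    by (simp add: hardy2_inner_sum_left tm_basis_hardy R hardy2_inner_commute[OF R tm_basis_hardy])
  moreover have "hardy2_inner (\<lambda>z. f z - ?S z) ?R = hardy2_inner f ?R - hardy2_inner ?S ?R"
    by (intro hardy2_inner_diff_left hardy_class_sum tm_basis_hardy f R)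
  moreover have "(\<lambda>z. f z - ?S z) = ?R"
    by (simp add: remainder_def[abs_def])
  ultimately show ?thesis
    using hardy2_inner_self[OF R] by simp
qed

text \<open>Pythagoras for the projection onto an orthonormal system.\<close>

lemma hardy_norm2_remainder:
  assumes f: "f \<in> hardy_class"
  shows "hardy_norm2 (remainder f N) = hardy_norm2 f - (\<Sum>j<N. (cmod (hardy2_inner f (tm_basis j)))\<^sup>2)"
proof -
  let ?S = "\<lambda>z. \<Sum>j<N. hardy2_inner f (tm_basis j) * tm_basis j z"
  have S: "?S \<in> hardy_class"
    by (intro hardy_class_sum tm_basis_hardy)
  have "hardy2_inner ?S f = (\<Sum>j<N. hardy2_inner f (tm_basis j) * cnj (hardy2_inner f (tm_basis j)))"
    by (simp add: hardy2_inner_sum_left tm_basis_hardy f hardy2_inner_commute[OF f tm_basis_hardy])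
  also have "\<dots> = of_real (\<Sum>j<N. (cmod (hardy2_inner f (tm_basis j)))\<^sup>2)"
    by (simp add: complex_norm_square del: of_real_power)
  finally have "hardy2_inner f ?S = of_real (\<Sum>j<N. (cmod (hardy2_inner f (tm_basis j)))\<^sup>2)"
    by (subst hardy2_inner_commute[OF S f]) (simp only: complex_cnj_complex_of_real)
  then have "complex_of_real (hardy_norm2 (remainder f N)) = of_real (hardy_norm2 f - (\<Sum>j<N. (cmod (hardy2_inner f (tm_basis j)))\<^sup>2))"
    using hardy2_inner_diff_right[OF f S f] hardy2_inner_self[OF f]
    by (simp add: inner_remainder[OF f, symmetric]) (simp add: remainder_def[abs_def])
  then show ?thesis
    by (simp only: of_real_eq_iff)
qed

text \<open>Bessel's inequality, from the nonnegative norm of each remainder.\<close>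

lemma summable_tm_coeffs:
  assumes f: "f \<in> hardy_class"
  shows "summable (\<lambda>j. (cmod (hardy2_inner f (tm_basis j)))\<^sup>2)"
proof (rule bounded_imp_summable)
  fix n
  show "(\<Sum>j\<le>n. (cmod (hardy2_inner f (tm_basis j)))\<^sup>2) \<le> hardy_norm2 f"
    using hardy_norm2_nonneg[OF remainder_hardy[OF f], of "Suc n"]
    by (simp add: hardy_norm2_remainder[OF f] lessThan_Suc_atMost)
qed auto

end

subsection \<open>Expansion of functions orthogonal to a zero space\<close>

lemma hardy_norm2_diff_le:
  assumes f: "f \<in> hardy_class" and g: "g \<in> hardy_class"
  shows "hardy_norm2 (\<lambda>z. f z - g z) \<le> 2 * (hardy_norm2 f + hardy_norm2 g)"
proof -
  have "hardy_norm2 (\<lambda>z. f z - g z) \<le> (\<Sum>n. 2 * ((cmod (taylor_coeff f n))\<^sup>2 + (cmod (taylor_coeff g n))\<^sup>2))"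
    unfolding hardy_norm2_def
  proof (rule suminf_le)
    show "(cmod (taylor_coeff (\<lambda>z. f z - g z) n))\<^sup>2 \<le>
        2 * ((cmod (taylor_coeff f n))\<^sup>2 + (cmod (taylor_coeff g n))\<^sup>2)" for n
      using norm_add_square_le[of "taylor_coeff f n" "- taylor_coeff g n"] f g
      by (simp add: taylor_coeff_diff hardy_class_holomorphic)
  qed (use f g in \<open>auto intro!: hardy_class_summable hardy_class_diff summable_add summable_mult\<close>)
  also have "\<dots> = 2 * (hardy_norm2 f + hardy_norm2 g)"
    unfolding hardy_norm2_def suminf_add[OF hardy_class_summable[OF f] hardy_class_summable[OF g]]
    by (intro suminf_mult summable_add hardy_class_summable f g)
  finally show ?thesis .
qed

text \<open>Coefficientwise convergence under a norm bound. Finite coefficient sums of the limit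
  inherit the bound \<open>C\<close>, which puts it into the class, and the differences then tend
  weakly to 0 by \<open>l2_weak_convergence_zero\<close>.\<close>

lemma bounded_coefficient_limit:
  assumes h: "\<And>N. h N \<in> hardy_class" "\<And>N. hardy_norm2 (h N) \<le> C"
    and g: "g holomorphic_on ball 0 1"
    and lim: "\<And>n. (\<lambda>N. taylor_coeff (h N) n) \<longlonglongrightarrow> taylor_coeff g n"
  shows "g \<in> hardy_class"
    and "f \<in> hardy_class \<Longrightarrow> (\<lambda>N. hardy2_inner f (h N)) \<longlonglongrightarrow> hardy2_inner f g"
proof -
  have "summable (\<lambda>n. (cmod (taylor_coeff g n))\<^sup>2)"
  proof (rule bounded_imp_summable)
    fix m
    have "(\<lambda>N. \<Sum>n\<le>m. (cmod (taylor_coeff (h N) n))\<^sup>2) \<longlonglongrightarrow> (\<Sum>n\<le>m. (cmod (taylor_coeff g n))\<^sup>2)"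
      by (intro tendsto_intros lim)
    moreover have "(\<Sum>n\<le>m. (cmod (taylor_coeff (h N) n))\<^sup>2) \<le> C" for N
      using h(2)[of N] sum_le_suminf[OF hardy_class_summable[OF h(1)[of N]], of "{..m}"]
      unfolding hardy_norm2_def by force
    ultimately show "(\<Sum>n\<le>m. (cmod (taylor_coeff g n))\<^sup>2) \<le> C"
      by (intro LIMSEQ_le_const2) auto
  qed auto
  then show g': "g \<in> hardy_class"
    using g by (simp add: hardy_class_def)
  assume f: "f \<in> hardy_class"
  let ?d = "\<lambda>N z. h N z - g z"
  have d: "?d N \<in> hardy_class" for N
    by (intro hardy_class_diff h g')
  have "(\<lambda>N. hardy2_inner f (?d N)) \<longlonglongrightarrow> 0"
    unfolding hardy2_inner_def
  proof (rule l2_weak_convergence_zero)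
    show "(\<Sum>n. (cmod (taylor_coeff (?d N) n))\<^sup>2) \<le> 2 * (C + hardy_norm2 g)" for N
      using hardy_norm2_diff_le[OF h(1) g', of N] h(2)[of N] by (simp add: hardy_norm2_def)
    show "(\<lambda>N. taylor_coeff (?d N) n) \<longlonglongrightarrow> 0" for n
      using tendsto_diff[OF lim[of n] tendsto_const[of "taylor_coeff g n"]] g h
      by (simp add: taylor_coeff_diff hardy_class_holomorphic)
  qed (intro hardy_class_summable f d)+
  then have "(\<lambda>N. hardy2_inner f (?d N) + hardy2_inner f g) \<longlonglongrightarrow> 0 + hardy2_inner f g"
    by (intro tendsto_intros)
  then show "(\<lambda>N. hardy2_inner f (h N)) \<longlonglongrightarrow> hardy2_inner f g"
    by (simp add: hardy2_inner_diff_right h g' f)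
qed

locale takenaka_malmquist_blaschke = takenaka_malmquist +
  assumes blaschke: "summable (\<lambda>j. 1 - norm (b j))"
begin

lemma one_minus_norm_b_square_le: "1 - (cmod (b j))\<^sup>2 \<le> 2 * (1 - cmod (b j))"
  using sum_squares_bound[of "cmod (b j)" 1] by simp

lemma summable_one_minus_norm_square: "summable (\<lambda>j. 1 - (cmod (b j))\<^sup>2)"
proof (rule summable_comparison_test'[OF summable_mult[OF blaschke, of 2], where N = 0])
  show "norm (1 - (cmod (b j))\<^sup>2) \<le> 2 * (1 - cmod (b j))" for j
    using one_minus_norm_b_square[of j] one_minus_norm_b_square_le[of j] by simp
qed

text \<open>Off the closed disk the factors have modulus above 1, but only by a summable amount.\<close>
lemma tm_basis_bound:
  assumes d: "0 < d" and R: "\<And>w. w \<in> S \<Longrightarrow> norm w \<le> R"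
    and S: "\<And>w j. w \<in> S \<Longrightarrow> d \<le> norm (1 - cnj (b j) * w)"
  shows "\<exists>M. \<forall>w\<in>S. \<forall>j. cmod (tm_basis j w) \<le> M * sqrt (1 - (cmod (b j))\<^sup>2)"
proof -
  let ?e = "\<lambda>j. 1 - (cmod (b j))\<^sup>2"
  \<comment> \<open>By \<open>norm_Moebius_square\<close>, the squared modulus of the factor at
    \<open>b j\<close> exceeds 1 on \<open>S\<close> by at most \<open>K * ?e j\<close>. Bounding it
    by an exponential turns the product into the convergent sum of the \<open>?e j\<close>.\<close>
  define K where "K = R\<^sup>2 / d\<^sup>2"
  have K: "0 \<le> K"
    by (simp add: K_def)
  have factor: "(cmod (Moebius_function 0 (b j) w))\<^sup>2 \<le> exp (K * ?e j)" if w: "w \<in> S" for w j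
  proof -
    have nz: "1 - cnj (b j) * w \<noteq> 0"
      using S[OF w, of j] d by auto
    have "((cmod w)\<^sup>2 - 1) * ?e j / (cmod (1 - cnj (b j) * w))\<^sup>2 \<le> R\<^sup>2 * ?e j / d\<^sup>2"
    proof (rule frac_le)
      have "(cmod w)\<^sup>2 - 1 \<le> R\<^sup>2"
        using power_mono[OF R[OF w], of 2] by simp
      then show "((cmod w)\<^sup>2 - 1) * ?e j \<le> R\<^sup>2 * ?e j"
        using one_minus_norm_b_square[of j] by (intro mult_right_mono) auto
      show "d\<^sup>2 \<le> (cmod (1 - cnj (b j) * w))\<^sup>2"
        using S[OF w] d by (intro power_mono) auto
    qed (use d one_minus_norm_b_square[of j] in auto)
    then have "(cmod (Moebius_function 0 (b j) w))\<^sup>2 \<le> 1 + K * ?e j"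
      unfolding norm_Moebius_square[OF nz] K_def by simp
    then show ?thesis
      using exp_ge_add_one_self[of "K * ?e j"] by linarith
  qed
  have prod: "(cmod (blaschke_prod {..<n} w))\<^sup>2 \<le> exp (K * (\<Sum>j. ?e j))" if w: "w \<in> S" for w n
  proof -
    have "(cmod (blaschke_prod {..<n} w))\<^sup>2 = (\<Prod>j<n. (cmod (Moebius_function 0 (b j) w))\<^sup>2)"
      by (simp add: blaschke_prod_def prod_norm[symmetric] prod_power_distrib)
    also have "\<dots> \<le> (\<Prod>j<n. exp (K * ?e j))"
      using factor[OF w] by (intro prod_mono) auto
    also have "\<dots> = exp (K * (\<Sum>j<n. ?e j))"
      by (simp add: exp_sum sum_distrib_left)
    also have "\<dots> \<le> exp (K * (\<Sum>j. ?e j))"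
      using K summable_one_minus_norm_square one_minus_norm_b_square[THEN less_imp_le]
      by (intro exp_le_cancel_iff[THEN iffD2] mult_left_mono sum_le_suminf) auto
    finally show ?thesis .
  qed
  define M where "M = sqrt (exp (K * (\<Sum>j. ?e j))) / d"
  have "cmod (tm_basis j w) \<le> M * sqrt (?e j)" if w: "w \<in> S" for w j
  proof -
    have "cmod (blaschke_prod {..<j} w) \<le> sqrt (exp (K * (\<Sum>j. ?e j)))"
      using prod[OF w] by (intro real_le_rsqrt)
    then have "cmod (blaschke_prod {..<j} w) * cmod (szego_kernel (b j) w) \<le> sqrt (exp (K * (\<Sum>j. ?e j))) * (1 / d)"
      using S[OF w, of j] d
      by (intro mult_mono) (auto simp: szego_kernel_def norm_divide intro!: divide_left_mono mult_pos_pos)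
    then have "sqrt (?e j) * (cmod (blaschke_prod {..<j} w) * cmod (szego_kernel (b j) w)) \<le> sqrt (?e j) * M"
      using one_minus_norm_b_square[of j] by (intro mult_left_mono) (auto simp: M_def)
    then show ?thesis
      using one_minus_norm_b_square[of j] by (simp add: tm_basis_def norm_mult mult.commute)
  qed
  then show ?thesis by blast
qed

text \<open>One series on the whole plane serves both as the sum in the disk and as its
  continuation. The value carries information only where the series converges.\<close>

definition expansion :: "(complex \<Rightarrow> complex) \<Rightarrow> complex \<Rightarrow> complex" where
  "expansion f w = (\<Sum>j. hardy2_inner f (tm_basis j) * tm_basis j w)"

text \<open>The Weierstrass test. The product of a Fourier coefficient and
  \<open>sqrt (?e j)\<close> is at most the sum of their squares, which are summable by Bessel and
  by Blaschke's condition respectively.\<close>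

lemma uniform_limit_expansion:
  assumes f: "f \<in> hardy_class" and d: "0 < d" and R: "\<And>w. w \<in> S \<Longrightarrow> norm w \<le> R"
    and S: "\<And>w j. w \<in> S \<Longrightarrow> d \<le> norm (1 - cnj (b j) * w)"
  shows "uniform_limit S (\<lambda>N w. \<Sum>j<N. hardy2_inner f (tm_basis j) * tm_basis j w) (expansion f) sequentially"
proof -
  let ?c = "\<lambda>j. cmod (hardy2_inner f (tm_basis j))" and ?e = "\<lambda>j. 1 - (cmod (b j))\<^sup>2"
  obtain M where M: "\<And>w j. w \<in> S \<Longrightarrow> cmod (tm_basis j w) \<le> M * sqrt (?e j)"
    using tm_basis_bound[OF d R S] by metis
  have "summable (\<lambda>j. \<bar>M\<bar> * ((?c j)\<^sup>2 + ?e j))"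
    by (intro summable_mult summable_add summable_tm_coeffs f summable_one_minus_norm_square)
  moreover have "norm (hardy2_inner f (tm_basis j) * tm_basis j w) \<le> \<bar>M\<bar> * ((?c j)\<^sup>2 + ?e j)" if w: "w \<in> S" for w j
  proof -
    have "cmod (tm_basis j w) \<le> \<bar>M\<bar> * sqrt (?e j)"
      using M[OF w, of j] one_minus_norm_b_square[of j]
      by (intro order_trans[OF M[OF w]] mult_right_mono) auto
    then have "norm (hardy2_inner f (tm_basis j) * tm_basis j w) \<le> ?c j * (\<bar>M\<bar> * sqrt (?e j))"
      unfolding norm_mult by (intro mult_left_mono) auto
    also have "\<dots> = \<bar>M\<bar> * (?c j * sqrt (?e j))"
      by simp
    also have "?c j * sqrt (?e j) \<le> (?c j)\<^sup>2 + (sqrt (?e j))\<^sup>2"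
    proof -
      have "0 \<le> ?c j * sqrt (?e j)"
        using one_minus_norm_b_square[of j] by simp
      then show ?thesis
        using sum_squares_bound[of "?c j" "sqrt (?e j)"] by linarith
    qed
    then have "\<bar>M\<bar> * (?c j * sqrt (?e j)) \<le> \<bar>M\<bar> * ((?c j)\<^sup>2 + ?e j)"
      using one_minus_norm_b_square[of j] by (intro mult_left_mono) auto
    finally show ?thesis .
  qed
  ultimately show ?thesis
    unfolding expansion_def[abs_def] by (intro Weierstrass_m_test)
qed

lemma tm_basis_holomorphic:
  assumes "\<And>w j. w \<in> S \<Longrightarrow> 1 - cnj (b j) * w \<noteq> 0"
  shows "tm_basis j holomorphic_on S"
  unfolding tm_basis_def[abs_def] blaschke_prod_def szego_kernel_def Moebius_function_simple
  using assms by (intro holomorphic_intros) auto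

lemma uniform_limit_expansion_cball:
  assumes f: "f \<in> hardy_class" and r: "0 \<le> r" "r < 1"
  shows "uniform_limit (cball 0 r) (\<lambda>N w. \<Sum>j<N. hardy2_inner f (tm_basis j) * tm_basis j w) (expansion f) sequentially"
proof (rule uniform_limit_expansion[OF f])
  fix w :: complex and j
  assume w: "w \<in> cball 0 r"
  have "norm (cnj (b j) * w) \<le> 1 * r"
    unfolding norm_mult using w norm_b[of j] r by (intro mult_mono) auto
  then show "1 - r \<le> norm (1 - cnj (b j) * w)"
    using norm_triangle_ineq2[of 1 "cnj (b j) * w"] by simp
qed (use r in auto)

text \<open>The local form of the convergence that \<open>holomorphic_uniform_sequence\<close> asks
  for; the radius is half the distance to the circle.\<close>

lemma uniform_limit_expansion_cball_in_disk:
  assumes f: "f \<in> hardy_class" and x: "x \<in> ball 0 1"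
  shows "\<exists>e>0. cball x e \<subseteq> ball 0 1 \<and>
    uniform_limit (cball x e) (\<lambda>N w. \<Sum>j<N. hardy2_inner f (tm_basis j) * tm_basis j w) (expansion f) sequentially"
proof -
  define e where "e = (1 - norm x) / 2"
  have e: "0 < e" "norm x + e < 1"
    using x by (auto simp: e_def field_simps)
  have sub: "cball x e \<subseteq> cball 0 (norm x + e)"
    by (subst cball_subset_cball_iff) (simp add: dist_norm)
  also have "\<dots> \<subseteq> ball 0 1"
    using e by auto
  finally have "cball x e \<subseteq> ball 0 1" .
  moreover have "uniform_limit (cball x e) (\<lambda>N w. \<Sum>j<N. hardy2_inner f (tm_basis j) * tm_basis j w) (expansion f) sequentially"
    using uniform_limit_expansion_cball[OF f, of "norm x + e"] e sub by (auto intro: uniform_limit_on_subset)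
  ultimately show ?thesis
    using e by blast
qed

lemma expansion_holomorphic_disk:
  assumes f: "f \<in> hardy_class"
  shows "expansion f holomorphic_on ball 0 1"
  by (rule holomorphic_uniform_sequence[OF _ _ uniform_limit_expansion_cball_in_disk[OF f]])
     (auto intro!: hardy_class_holomorphic hardy_class_sum tm_basis_hardy)

text \<open>On the circle |1 - cnj b l| = |b - l|, which is at least 2d. Moving from
  \<open>l\<close> to a point of \<open>ball l d\<close> costs at most d, so the denominators stay
  at least d there and the uniform bound applies.\<close>

lemma expansion_holomorphic:
  assumes f: "f \<in> hardy_class" and l: "norm l = 1" and d: "0 < d"
    and far: "\<And>j. 2 * d \<le> norm (b j - l)"
  shows "expansion f holomorphic_on ball 0 1 \<union> ball l d"
proof (rule holomorphic_uniform_sequence)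
  have near: "d \<le> norm (1 - cnj (b j) * w)" if w: "w \<in> ball l d" for w j
  proof -
    \<comment> \<open>Since \<open>l\<close> is on the circle, 1 is replaced by
      \<open>cnj l * l\<close>.\<close>
    have "norm (1 - cnj (b j) * l) = norm (cnj (l - b j) * l)"
      using l complex_norm_square[of l] by (simp add: algebra_simps)
    then have "2 * d \<le> norm (1 - cnj (b j) * l)"
      using far[of j] l by (simp add: norm_mult norm_minus_commute del: complex_cnj_diff)
    moreover have "norm (cnj (b j) * (w - l)) \<le> 1 * d"
      unfolding norm_mult using w norm_b[of j] by (intro mult_mono) (auto simp: dist_norm norm_minus_commute)
    moreover have "norm (1 - cnj (b j) * l) \<le> norm (1 - cnj (b j) * w) + norm (cnj (b j) * (w - l))"
      using norm_triangle_ineq[of "1 - cnj (b j) * w" "cnj (b j) * (w - l)"] by (simp add: algebra_simps)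
    ultimately show ?thesis by simp
  qed
  have "1 - cnj (b j) * w \<noteq> 0" if "w \<in> ball 0 1 \<union> ball l d" for w j
    using that near[of w j] d one_minus_cnj_mult_nonzero[OF norm_b, of w j] by auto
  then show "(\<lambda>w. \<Sum>j<N. hardy2_inner f (tm_basis j) * tm_basis j w) holomorphic_on ball 0 1 \<union> ball l d" for N
    by (intro holomorphic_intros tm_basis_holomorphic) auto
  fix x
  assume "x \<in> ball 0 1 \<union> ball l d"
  then consider "x \<in> ball 0 1" | "x \<in> ball l d" by blast
  then show "\<exists>e>0. cball x e \<subseteq> ball 0 1 \<union> ball l d \<and>
      uniform_limit (cball x e) (\<lambda>N w. \<Sum>j<N. hardy2_inner f (tm_basis j) * tm_basis j w) (expansion f) sequentially"
  proof cases
    case 1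
    then show ?thesis
      using uniform_limit_expansion_cball_in_disk[OF f] by blast
  next
    case 2
    obtain e where e: "0 < e" "cball x e \<subseteq> ball l d"
      using 2 open_contains_cball[of "ball l d"] by blast
    have "uniform_limit (ball l d) (\<lambda>N w. \<Sum>j<N. hardy2_inner f (tm_basis j) * tm_basis j w) (expansion f) sequentially"
    proof (rule uniform_limit_expansion[OF f d])
      fix w assume "w \<in> ball l d"
      then show "norm w \<le> 1 + d"
        using norm_triangle_ineq[of l "w - l"] l by (simp add: dist_norm norm_minus_commute)
    qed (rule near)
    then show ?thesis
      using e uniform_limit_on_subset[OF _ e(2)] by blast
  qed
qed auto

text \<open>The remainders converge to some \<open>r\<close> that vanishes at all \<open>b\<^sub>j\<close>, so \<open>f\<close> is orthogonal to \<open>r\<close>;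
  but \<open>\<langle>f, remainder f N\<rangle> = \<parallel>remainder f N\<parallel>\<^sup>2\<close>, so the remainders tend to \<open>0\<close> in norm.\<close>
lemma expansion_eq:
  assumes f: "f \<in> hardy2_orth (zero_space (range b))" and w: "norm w < 1"
  shows "expansion f w = f w"
proof -
  have f': "f \<in> hardy_class" and orth: "\<And>g. g \<in> zero_space (range b) \<Longrightarrow> hardy2_inner f g = 0"
    using f by (auto simp: hardy2_orth_def hardy2_subset_hardy_class)
  have hol: "f holomorphic_on ball 0 1"
    using f' by (rule hardy_class_holomorphic)
  define r where "r = (\<lambda>z. f z - expansion f z)"
  have lim: "uniform_limit (cball 0 q) (remainder f) r sequentially" if "0 \<le> q" "q < 1" for q
    unfolding remainder_def[abs_def] r_def
    using uniform_limit_expansion_cball[OF f' that] by (intro uniform_limit_intros)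
  have pointwise: "(\<lambda>N. remainder f N z) \<longlonglongrightarrow> r z" if "norm z < 1" for z
    using lim[of "norm z"] that by (intro tendsto_uniform_limitI[where S = "cball 0 (norm z)"]) auto
  have norm_le: "hardy_norm2 (remainder f N) \<le> hardy_norm2 f" for N
    by (simp add: hardy_norm2_remainder[OF f'] sum_nonneg)
  have holr: "r holomorphic_on ball 0 1"
    unfolding r_def by (intro holomorphic_intros hol expansion_holomorphic_disk f')
  \<comment> \<open>Locally uniform convergence of holomorphic functions near 0 carries over to all
    derivatives at 0.\<close>
  have coeff: "(\<lambda>N. taylor_coeff (remainder f N) n) \<longlonglongrightarrow> taylor_coeff r n" for n
    unfolding taylor_coeff_def
  proof (intro tendsto_divide tendsto_const higher_deriv_complex_uniform_limit)
    show "uniform_limit (ball 0 (1/2)) (remainder f) r sequentially"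
      using lim[of "1/2"] by (rule uniform_limit_on_subset) auto
    show "\<forall>\<^sub>F N in sequentially. remainder f N holomorphic_on ball 0 (1/2)"
      by (intro always_eventually allI holomorphic_on_subset[OF hardy_class_holomorphic[OF remainder_hardy[OF f']]]) auto
  qed auto
  have r: "r \<in> hardy_class"
    using bounded_coefficient_limit(1)[OF remainder_hardy[OF f'] norm_le holr coeff] .
  have "r (b j) = 0" for j
  proof -
    \<comment> \<open>The remainder vanishes at \<open>b j\<close> as soon as \<open>N\<close>
      exceeds \<open>j\<close>.\<close>
    have "eventually (\<lambda>N. remainder f N (b j) = 0) sequentially"
      using eventually_gt_at_top[of j] by eventually_elim (rule remainder_zero[OF f'])
    then have "(\<lambda>N. remainder f N (b j)) \<longlonglongrightarrow> 0"
      by (rule tendsto_eventually)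
    then show ?thesis
      using pointwise[OF norm_b] LIMSEQ_unique by blast
  qed
  \<comment> \<open>Members of \<open>zero_space\<close> must be 0 off the disk, so \<open>r\<close>
    is cut off; this leaves its inner products unchanged.\<close>
  then have "(\<lambda>z. if z \<in> ball 0 1 then r z else 0) \<in> zero_space (range b)"
    using hardy_class_cut[OF r] by (auto simp: zero_space_def)
  then have "hardy2_inner f (\<lambda>z. if z \<in> ball 0 1 then r z else 0) = 0"
    by (rule orth)
  then have "hardy2_inner f r = 0"
    using hardy2_inner_cong[of f f r "\<lambda>z. if z \<in> ball 0 1 then r z else 0"] by simp
  \<comment> \<open>Weak convergence gives \<open>hardy2_inner f r = 0\<close> as the limit of the
    inner products of \<open>f\<close> with the remainders, and these equal the squared
    norms.\<close>
  then have "(\<lambda>N. complex_of_real (hardy_norm2 (remainder f N))) \<longlonglongrightarrow> of_real 0"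
    using bounded_coefficient_limit(2)[OF remainder_hardy[OF f'] norm_le holr coeff f']
    by (simp add: inner_remainder[OF f'])
  then have to0: "(\<lambda>N. hardy_norm2 (remainder f N)) \<longlonglongrightarrow> 0"
    by (simp only: tendsto_of_real_iff)
  have "(cmod w)\<^sup>2 < 1"
    using w by (simp add: abs_square_less_1)
  have "(cmod (r w))\<^sup>2 \<le> 0 / (1 - (cmod w)\<^sup>2)"
  proof (rule LIMSEQ_le)
    show "(\<lambda>N. (cmod (remainder f N w))\<^sup>2) \<longlonglongrightarrow> (cmod (r w))\<^sup>2"
      by (intro tendsto_intros pointwise w)
    show "(\<lambda>N. hardy_norm2 (remainder f N) / (1 - (cmod w)\<^sup>2)) \<longlonglongrightarrow> 0 / (1 - (cmod w)\<^sup>2)"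
      using \<open>(cmod w)\<^sup>2 < 1\<close> by (intro tendsto_divide tendsto_const to0) linarith
    show "\<exists>M. \<forall>N\<ge>M. (cmod (remainder f N w))\<^sup>2 \<le> hardy_norm2 (remainder f N) / (1 - (cmod w)\<^sup>2)"
      using norm_square_le_hardy_norm2[OF remainder_hardy[OF f'] w] by blast
  qed
  then have "r w = 0"
    by simp
  then show ?thesis
    unfolding r_def by simp
qed

end

subsection \<open>Analytic continuation across the boundary\<close>

text \<open>If the chosen limit point \<open>l\<close> of \<open>A\<close> is inside the disk, the
  identity theorem applies to \<open>f\<close> directly. If it is on the circle, it applies to the
  continuation given by \<open>expansion f\<close>.\<close>

lemma zero_space_inter_orth_trivial:
  assumes A: "A \<subseteq> ball 0 1" and B: "B \<subseteq> ball 0 1" and inf: "infinite B" and bl: "blaschke_condition B"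
    and lim: "\<not> limit_set A \<subseteq> limit_set B"
    and f: "f \<in> zero_space A" "f \<in> hardy2_orth (zero_space B)"
  shows "f = (\<lambda>_. 0)"
proof -
  obtain l where l: "l \<in> closure A" "l \<notin> A" "l \<notin> closure B - B"
    using lim unfolding limit_set_def by (meson DiffE subsetI)
  have islim: "l islimpt A"
    using l by (auto simp: closure_def)
  have f': "f \<in> hardy2" "\<And>a. a \<in> A \<Longrightarrow> f a = 0"
    using f by (auto simp: zero_space_def)
  then have hf: "f \<in> hardy_class" and out: "\<And>z. z \<notin> ball 0 1 \<Longrightarrow> f z = 0"
    by (auto simp: hardy2_def hardy_class_def)
  have hol: "f holomorphic_on ball 0 1"
    using hf by (rule hardy_class_holomorphic)
  have "closure A \<subseteq> cball 0 1"
    using A ball_subset_cball by (intro closure_minimal) auto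
  then have "l \<in> cball 0 1"
    using l(1) by blast
  then consider "norm l < 1" | "norm l = 1"
    by fastforce
  then have "f z = 0" if z: "z \<in> ball 0 1" for z
  proof cases
    case 1
    then show ?thesis
      using analytic_continuation[OF hol open_ball connected_ball A _ islim f'(2) z] by simp
  next
    case 2
    \<comment> \<open>A summable family has only countably many nonzero terms, and on
      \<open>B\<close> every term is positive. This is what permits enumerating \<open>B\<close> by
      a sequence.\<close>
    have "{a \<in> B. 1 - cmod a \<noteq> 0} = B"
      using B by auto
    then have "countable B"
      using summable_countable_real[OF bl[unfolded blaschke_condition_def]] by simp
    then obtain b :: "nat \<Rightarrow> complex" where b: "bij_betw b UNIV B"
      using inf bij_betw_from_nat_into by blast
    then have range: "range b = B"
      by (simp add: bij_betw_def)
    have nb: "norm (b j) < 1" for j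
      using B range by (metis mem_ball_0 rangeI subsetD)
    have "(\<lambda>j. 1 - norm (b j)) summable_on UNIV"
      using bl summable_on_reindex_bij_betw[OF b, of "\<lambda>a. 1 - norm a"]
      by (simp add: blaschke_condition_def)
    then have "summable (\<lambda>j. 1 - norm (b j))"
      by (rule summable_on_imp_summable)
    then interpret takenaka_malmquist_blaschke b
      using nb by unfold_locales
    \<comment> \<open>A point of the circle is not in \<open>B\<close>, so \<open>l\<close> misses
      the whole closure of \<open>B\<close> and has a positive distance \<open>e\<close> from
      \<open>B\<close>. Halving it yields the factor 2 in
      \<open>expansion_holomorphic\<close>.\<close>
    have "l \<notin> B"
      using B 2 by auto
    then have "l \<notin> closure B"
      using l(3) by blast
    then obtain e where e: "0 < e" "\<And>y. y \<in> B \<Longrightarrow> e \<le> dist y l"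
      unfolding closure_approachable by (meson not_less)
    define d where "d = e / 2"
    have d: "0 < d" and far: "2 * d \<le> norm (b j - l)" for j
      using e(1) e(2)[of "b j"] rangeI[of b j] unfolding range by (simp_all add: d_def dist_norm)
    \<comment> \<open>A point of \<open>A\<close> close to \<open>l\<close> witnesses that the two
      discs overlap, which makes their union connected.\<close>
    obtain a where "a \<in> A" "dist a l < d"
      using l(1) d unfolding closure_approachable by blast
    then have "a \<in> ball 0 1 \<inter> ball l d"
      using A by (auto simp: dist_commute)
    then have "ball 0 1 \<inter> ball l d \<noteq> {}"
      by blast
    then have conn: "connected (ball 0 1 \<union> ball l d)"
      by (intro connected_Un) auto
    have eq: "expansion f z = f z" if "z \<in> ball 0 1" for z
      by (rule expansion_eq) (use f(2) range that in simp_all)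
    have hol': "expansion f holomorphic_on ball 0 1 \<union> ball l d"
      using hf 2 d far by (rule expansion_holomorphic)
    have op: "open (ball 0 1 \<union> ball l d)"
      by (intro open_Un open_ball)
    have "expansion f z = 0"
    proof (rule analytic_continuation[OF hol' op conn _ _ islim])
      show "A \<subseteq> ball 0 1 \<union> ball l d" "z \<in> ball 0 1 \<union> ball l d"
        using A z by blast+
      show "l \<in> ball 0 1 \<union> ball l d"
        using d by simp
      show "expansion f a = 0" if "a \<in> A" for a
        using eq[OF subsetD[OF A that]] f'(2)[OF that] by simp
    qed
    then show ?thesis
      using eq[OF z] by simp
  qed
  then show ?thesis
    using out by (intro ext) metis
qed

lemma zero_in_hardy2: "(\<lambda>_. 0) \<in> hardy2"
  using hardy_class_zero by (simp add: hardy2_def hardy_class_def)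

lemma zero_in_intersection: "(\<lambda>_. 0) \<in> zero_space A \<inter> hardy2_orth (zero_space B)"
  by (simp add: zero_space_def hardy2_orth_def zero_in_hardy2 hardy2_inner_zero_left)

text \<open>The triviality lemma is applied twice, with \<open>A\<close> and \<open>B\<close>
  exchanged; the reverse inclusions hold because the zero function lies in both
  intersections.\<close>

theorem proposition5p2:
  fixes A B :: "complex set"
  assumes "A \<subseteq> ball 0 1" and "B \<subseteq> ball 0 1"
    and "infinite A" and "infinite B"
    and "A \<inter> B = {}"
    and "blaschke_condition A" and "blaschke_condition B"
    and "\<not> limit_set A \<subseteq> limit_set B"
    and "\<not> limit_set B \<subseteq> limit_set A"
  shows "zero_space A \<inter> hardy2_orth (zero_space B) = {\<lambda>_. 0} \<and>
         hardy2_orth (zero_space A) \<inter> zero_space B = {\<lambda>_. 0}"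
  using zero_space_inter_orth_trivial[OF assms(1,2,4,7,8)]
    zero_space_inter_orth_trivial[OF assms(2,1,3,6,9)]
    zero_in_intersection[of A B] zero_in_intersection[of B A]
  by blast

end
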